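(* Let $0<q<1$ and $x\in[0,1]$. For all integers $0\le j\le n$, $$\sum_{k=j}^n\frac{\binom{k}{j}}{\binom{n}{j}}\,B_{k,n}(x,q)=[x]_q^j .$$
   Context: For $r>0$, $r\ne1$ and real $y$, $[y]_r=\frac{1-r^y}{1-r}$. For integers $0\le k\le n$ and $x\in[0,1]$, $B_{k,n}(x,q)=\binom nk[x]_q^k[1-x]_{1/q}^{\,n-k}$. *)

theory Defs
  imports Complex_Main
begin

definition qnum :: "real \<Rightarrow> real \<Rightarrow> real" where
  "qnum r y = (1 - r powr y) / (1 - r)"

definition qBernstein :: "nat \<Rightarrow> nat \<Rightarrow> real \<Rightarrow> real \<Rightarrow> real" where
  "qBernstein k n x q = real (n choose k) * qnum q x ^ k * qnum (1 / q) (1 - x) ^ (n - k)"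

end

theory Submission
  imports Defs
begin

text \<open>Since $[x]_q + [1-x]_{1/q} = 1$, the $B_{k,n}(x,q)$ are the classical Bernstein polynomials
  evaluated at $[x]_q$. The identity $\binom nk\binom kj = \binom nj\binom{n-j}{k-j}$ then reduces
  the sum to $[x]_q^j\,([x]_q + [1-x]_{1/q})^{n-j}$.\<close>

text \<open>Expanding the fraction of \<open>qnum (1 / q) (1 - x)\<close> by -q brings it over the
  denominator 1 - q, with numerator q^x - q; this complements the numerator 1 - q^x of
  \<open>qnum q x\<close>.\<close>

lemma qnum_add_qnum_inverse:
  fixes q x :: real
  assumes "0 < q" and "q \<noteq> 1"
  shows "qnum q x + qnum (1 / q) (1 - x) = 1"
proof -
  have "(1 / q) powr (1 - x) = q powr x / q"
    using assms(1) by (simp add: powr_divide powr_diff)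
  then have "qnum (1 / q) (1 - x) = (q powr x - q) / (1 - q)"
    using assms by (simp add: qnum_def divide_simps) (simp add: algebra_simps)
  then show ?thesis
    using assms(2) by (simp add: qnum_def flip: add_divide_distrib)
qed

lemma sum_choose_binomial_terms:
  fixes a b :: "'a::field_char_0"
  assumes "j \<le> n"
  shows "(\<Sum>k=j..n. of_nat (k choose j) / of_nat (n choose j) * (of_nat (n choose k) * a ^ k * b ^ (n - k)))
         = a ^ j * (a + b) ^ (n - j)" (is "?L = _")
proof -
  have nz: "of_nat (n choose j) \<noteq> (0::'a)"
    using assms by simp
  have "?L = (\<Sum>k=j..n. a ^ j * (of_nat ((n - j) choose (k - j)) * a ^ (k - j) * b ^ (n - k)))"
  proof (rule sum.cong)
    fix k assume k: "k \<in> {j..n}"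
    have "of_nat (n choose k) * of_nat (k choose j)
          = (of_nat (n choose j) * of_nat ((n - j) choose (k - j)) :: 'a)"
      using k choose_mult[of j k n] by (simp flip: of_nat_mult)
    then have "of_nat (k choose j) / of_nat (n choose j) * of_nat (n choose k)
               = (of_nat ((n - j) choose (k - j)) :: 'a)"
      using nz by (simp add: field_simps)
    moreover have "a ^ k = a ^ j * a ^ (k - j)"
      using k by (simp flip: power_add)
    ultimately show "of_nat (k choose j) / of_nat (n choose j) * (of_nat (n choose k) * a ^ k * b ^ (n - k))
               = a ^ j * (of_nat ((n - j) choose (k - j)) * a ^ (k - j) * b ^ (n - k))"
      by (simp add: mult.assoc[symmetric])
  qed simp
  \<comment> \<open>Shifting by i = k - j turns n - k into n - j - i, so the sum becomes the full
    binomial expansion of degree n - j.\<close>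
  also have "\<dots> = (\<Sum>i\<le>n - j. a ^ j * (of_nat ((n - j) choose i) * a ^ i * b ^ (n - j - i)))"
    by (rule sum.reindex_bij_witness[of _ "\<lambda>i. i + j" "\<lambda>k. k - j"]) (use assms in auto)
  also have "\<dots> = a ^ j * (a + b) ^ (n - j)"
    by (simp add: binomial_ring sum_distrib_left)
  finally show ?thesis .
qed

theorem theorem9:
  fixes q x :: real and j n :: nat
  assumes "0 < q" and "q < 1" and "x \<in> {0..1}" and "j \<le> n"
  shows "(\<Sum>k=j..n. real (k choose j) / real (n choose j) * qBernstein k n x q) = qnum q x ^ j"
  \<comment> \<open>Without the deletion, the product would be pulled into the numerator and the
    summand would no longer match \<open>sum_choose_binomial_terms\<close>. What remains is a power
    of 1.\<close>
  using assms by (simp add: qBernstein_def sum_choose_binomial_terms qnum_add_qnum_inverse del: times_divide_eq_left)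

end
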